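(* Let $d \ge 1$, let $\Omega \subset \mathbb{R}^d$, let $\mu$ be a measure on $\Omega$, and let $k\colon \Omega\times\Omega\to\mathbb{R}$ be a kernel such that: (i) $P\Omega = \Omega$ for every $d \times d$ permutation and sign change matrix $P$; (ii) $\mu$ has a density $f_\mu$ with respect to the Lebesgue measure, and $f_\mu$ is a fully symmetric function; (iii) $k$ is positive-definite and fully symmetric; and $\int_\Omega \sqrt{k(x,x)}\,\mathrm{d}\mu(x)<\infty$. Let $\lambda^1,\dots,\lambda^J \in \Omega$ be vectors with non-negative coordinates such that the fully symmetric sets $[\lambda^1],\dots,[\lambda^J]$ are distinct, and let the node set be $\mathcal{X} = \bigcup_{j=1}^J [\lambda^j]$. Then the kernel quadrature rule $Q_k$ with node set $\mathcal{X}$ is fully symmetric, that is, there are $w_{\lambda^1},\dots,w_{\lambda^J}\in\mathbb{R}$ such that for every $f\colon \Omega\to\mathbb{R}$ $$Q_k(f) = \sum_{j=1}^J w_{\lambda^j} \sum_{x\in[\lambda^j]} f(x).$$ Furthermore, for all $i,j\in\{1,\dots,J\}$ the quantity $$S_{ij} = \sum_{x\in[\lambda^j]} k(x^i,x), \qquad x^i\in[\lambda^i],$$ does not depend on the choice of $x^i \in [\lambda^i]$, the $J\times J$ matrix $(S_{ij})_{i,j=1}^J$ is non-singular, and the weights $w_{\lambda^1},\dots,w_{\lambda^J}$ are the solution of the linear system $$\sum_{j=1}^J S_{ij}\, w_{\lambda^j} = k_\mu(\lambda^i), \qquad i=1,\dots,J.$$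
   Context: A permutation and sign change matrix is a $d\times d$ matrix having in each row and each column exactly one non-zero entry, that entry being $1$ or $-1$. For a vector $\lambda\in\mathbb{R}^d$ with non-negative coordinates, the fully symmetric set generated by $\lambda$ is $[\lambda] = \{P\lambda : P \text{ a permutation and sign change matrix}\}$, a finite set of points (without repetitions). A function $f\colon\Omega\to\mathbb{R}$ is fully symmetric if $f(Px)=f(x)$ for all $x\in\Omega$ and all permutation and sign change matrices $P$ with $Px \in \Omega$. A kernel $k$ on $\Omega$ (with $\Omega$ invariant under all such $P$) is fully symmetric if $k(Px,Px')=k(x,x')$ for all $x,x'\in\Omega$ and all such $P$. A (symmetric, measurable) kernel $k\colon\Omega\times\Omega\to\mathbb{R}$ is positive-definite if for every $n$ and any distinct $x_1,\dots,x_n\in\Omega$ the matrix $K=(k(x_i,x_j))_{i,j=1}^n$ is positive-definite (in the strict sense; in particular $K$ is non-singular). The kernel mean is $k_\mu(x)=\int_\Omega k(x,x')\,\mathrm{d}\mu(x')$. For a finite set of distinct nodes $\mathcal{X}=\{x_1,\dots,x_n\}\subset\Omega$, the kernel quadrature rule is $Q_k(f)=\sum_{i=1}^n w_i f(x_i)$, where $w=(w_1,\dots,w_n)$ is the unique solution of $Kw=(k_\mu(x_1),\dots,k_\mu(x_n))^{\mathsf T}$. (Equivalently, these are the weights minimising the worst-case error $\sup_{\|f\|_{\mathcal H}\le 1}|\int_\Omega f\,\mathrm{d}\mu-\sum_i w_i f(x_i)|$ over the unit ball of the reproducing kernel Hilbert space $\mathcal H$ of $k$.) *)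

theory Defs
  imports "HOL-Analysis.Analysis"
begin

definition perm_sign_matrix :: "real^'n^'n \<Rightarrow> bool" where
  "perm_sign_matrix P \<longleftrightarrow>
     (\<forall>i. \<exists>!j. P $ i $ j \<noteq> 0) \<and> (\<forall>j. \<exists>!i. P $ i $ j \<noteq> 0) \<and>
     (\<forall>i j. P $ i $ j \<noteq> 0 \<longrightarrow> P $ i $ j = 1 \<or> P $ i $ j = -1)"

definition fully_symmetric_set :: "real^'n \<Rightarrow> (real^'n) set" where
  "fully_symmetric_set v = {P *v v | P. perm_sign_matrix P}"

definition fully_symmetric_fun :: "(real^'n) set \<Rightarrow> (real^'n \<Rightarrow> real) \<Rightarrow> bool" where
  "fully_symmetric_fun \<Omega> f \<longleftrightarrow>
     (\<forall>x\<in>\<Omega>. \<forall>P. perm_sign_matrix P \<longrightarrow> P *v x \<in> \<Omega> \<longrightarrow> f (P *v x) = f x)"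

definition fully_symmetric_kernel :: "(real^'n) set \<Rightarrow> (real^'n \<Rightarrow> real^'n \<Rightarrow> real) \<Rightarrow> bool" where
  "fully_symmetric_kernel \<Omega> k \<longleftrightarrow>
     (\<forall>x\<in>\<Omega>. \<forall>x'\<in>\<Omega>. \<forall>P. perm_sign_matrix P \<longrightarrow> k (P *v x) (P *v x') = k x x')"

text \<open>
  The sigma-algebra of \<open>\<mu>\<close> may be any sub-sigma-algebra of the Lebesgue sets of \<open>\<Omega>\<close>; this covers
  both measures on the Borel subsets of \<open>\<Omega>\<close> and complete measures on its Lebesgue subsets.
\<close>

definition has_lebesgue_density ::
    "(real^'n) measure \<Rightarrow> (real^'n) set \<Rightarrow> (real^'n \<Rightarrow> real) \<Rightarrow> bool" where
  "has_lebesgue_density \<mu> \<Omega> f \<longleftrightarrow>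
     \<Omega> \<in> sets lebesgue \<and> space \<mu> = \<Omega> \<and> sets \<mu> \<subseteq> sets (lebesgue_on \<Omega>) \<and>
     f \<in> borel_measurable (lebesgue_on \<Omega>) \<and> (\<forall>x\<in>\<Omega>. 0 \<le> f x) \<and>
     (\<forall>A\<in>sets \<mu>. emeasure \<mu> A = emeasure (density (lebesgue_on \<Omega>) (\<lambda>x. ennreal (f x))) A)"

definition is_kernel :: "'a measure \<Rightarrow> ('a \<Rightarrow> 'a \<Rightarrow> real) \<Rightarrow> bool" where
  "is_kernel \<mu> k \<longleftrightarrow>
     (\<lambda>(x, y). k x y) \<in> borel_measurable (\<mu> \<Otimes>\<^sub>M \<mu>) \<and>
     (\<forall>x\<in>space \<mu>. \<forall>y\<in>space \<mu>. k x y = k y x)"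

definition positive_definite_kernel :: "'a set \<Rightarrow> ('a \<Rightarrow> 'a \<Rightarrow> real) \<Rightarrow> bool" where
  "positive_definite_kernel \<Omega> k \<longleftrightarrow>
     (\<forall>n. \<forall>x :: nat \<Rightarrow> 'a. inj_on x {..<n} \<longrightarrow> x ` {..<n} \<subseteq> \<Omega> \<longrightarrow>
        (\<forall>c :: nat \<Rightarrow> real. (\<exists>i<n. c i \<noteq> 0) \<longrightarrow>
           0 < (\<Sum>i<n. \<Sum>j<n. c i * k (x i) (x j) * c j)))"

definition kernel_mean :: "'a measure \<Rightarrow> ('a \<Rightarrow> 'a \<Rightarrow> real) \<Rightarrow> 'a \<Rightarrow> real" where
  "kernel_mean \<mu> k x = (\<integral>x'. k x x' \<partial>\<mu>)"

text \<open>
  Weights are indexed by the nodes themselves. Requiring them to vanish off the finite node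
  set \<open>X\<close> only makes the function unique; for a positive-definite kernel the linear system
  has exactly one solution on \<open>X\<close>.
\<close>

definition kernel_quadrature_weights ::
    "'a measure \<Rightarrow> ('a \<Rightarrow> 'a \<Rightarrow> real) \<Rightarrow> 'a set \<Rightarrow> 'a \<Rightarrow> real" where
  "kernel_quadrature_weights \<mu> k X =
     (THE w. (\<forall>x. x \<notin> X \<longrightarrow> w x = 0) \<and>
             (\<forall>x\<in>X. (\<Sum>y\<in>X. k x y * w y) = kernel_mean \<mu> k x))"

definition kernel_quadrature ::
    "'a measure \<Rightarrow> ('a \<Rightarrow> 'a \<Rightarrow> real) \<Rightarrow> 'a set \<Rightarrow> ('a \<Rightarrow> real) \<Rightarrow> real" where
  "kernel_quadrature \<mu> k X f = (\<Sum>x\<in>X. kernel_quadrature_weights \<mu> k X x * f x)"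

end

theory Submission
  imports Defs
begin

text \<open>
  The kernel mean is invariant under signed permutations, and so are the sums of the kernel over an
  orbit. A vector in the kernel of the matrix \<open>S\<close>, spread out to a function that is constant on
  each orbit, therefore lies in the kernel of the Gram matrix of all nodes and vanishes by strict
  positive-definiteness. So \<open>S\<close> is invertible, and spreading out the solution of the small system
  solves the full one, whose solution is unique.
\<close>

section \<open>The finite group of signed permutation matrices\<close>

text \<open>Normal form for entrywise computation: \<open>p i\<close> is the column of the single
  non-zero entry of row \<open>i\<close>, and \<open>s i\<close> is that entry. Uniqueness within
  columns makes \<open>p\<close> a bijection.\<close>

lemma perm_sign_matrixE:
  fixes P :: "real^'n^'n"
  assumes "perm_sign_matrix P"
  obtains p s where "bij p" "\<And>i. s i = 1 \<or> s i = - 1"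
    "\<And>i j. P $ i $ j = (if j = p i then s i else 0)"
proof -
  define p where "p i = (THE j. P $ i $ j \<noteq> 0)" for i
  have row: "\<exists>!j. P $ i $ j \<noteq> 0" and col: "\<exists>!i. P $ i $ j \<noteq> 0" for i j
    using assms by (auto simp: perm_sign_matrix_def)
  have p: "P $ i $ j \<noteq> 0 \<longleftrightarrow> j = p i" for i j
    unfolding p_def using theI'[OF row[of i]] row[of i] by blast
  show thesis
  proof (rule that[of p "\<lambda>i. P $ i $ p i"])
    show "bij p"
      unfolding bij_def inj_on_def surj_def by (metis p col)
    show "P $ i $ p i = 1 \<or> P $ i $ p i = - 1" for i
      using assms p[of i "p i"] by (auto simp: perm_sign_matrix_def)
    show "P $ i $ j = (if j = p i then P $ i $ p i else 0)" for i j
      using p by auto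
  qed
qed

lemma perm_sign_matrixI:
  fixes P :: "real^'n^'n"
  assumes "bij p" and s: "\<And>i. s i = 1 \<or> s i = - 1"
    and P: "\<And>i j. P $ i $ j = (if j = p i then s i else 0)"
  shows "perm_sign_matrix P"
proof -
  have "s i \<noteq> 0" for i
    using s[of i] by auto
  moreover have "\<exists>!i. j = p i" for j
    using \<open>bij p\<close> by (metis bij_pointE)
  ultimately show ?thesis
    using s unfolding perm_sign_matrix_def P by auto
qed

lemma signed_perm_mult_nth:
  fixes P :: "real^'n^'n"
  assumes "\<And>i j. P $ i $ j = (if j = p i then s i else 0)"
  shows "(P *v x) $ i = s i * x $ p i"
  by (simp add: matrix_vector_mult_def assms if_distrib[of "\<lambda>a. a * _"] cong: if_cong)

lemma perm_sign_matrix_mult: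
  fixes P Q :: "real^'n^'n"
  assumes "perm_sign_matrix P" "perm_sign_matrix Q"
  shows "perm_sign_matrix (P ** Q)"
proof -
  obtain p s where p: "bij p" "\<And>i. s i = 1 \<or> s i = - 1"
    "\<And>i j. P $ i $ j = (if j = p i then s i else 0)"
    by (rule perm_sign_matrixE[OF assms(1)]) blast
  obtain q t where q: "bij q" "\<And>i. t i = 1 \<or> t i = - 1"
    "\<And>i j. Q $ i $ j = (if j = q i then t i else 0)"
    by (rule perm_sign_matrixE[OF assms(2)]) blast
  show ?thesis
  proof (rule perm_sign_matrixI)
    \<comment> \<open>Row \<open>i\<close> of \<open>P\<close> selects row \<open>p i\<close> of
      \<open>Q\<close>, up to the sign \<open>s i\<close>, and the entry of that row sits in column
      \<open>q (p i)\<close>.\<close>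
    show "bij (q \<circ> p)"
      using p(1) q(1) by (rule bij_comp)
    show "s i * t (p i) = 1 \<or> s i * t (p i) = - 1" for i
      using p(2)[of i] q(2)[of "p i"] by auto
    show "(P ** Q) $ i $ j = (if j = (q \<circ> p) i then s i * t (p i) else 0)" for i j
      by (simp add: matrix_matrix_mult_def p(3)[of i] q(3)[of "p i"] if_distrib[of "\<lambda>a. a * _"]
          cong: if_cong)
  qed
qed

lemma perm_sign_matrix_transpose:
  "perm_sign_matrix P \<Longrightarrow> perm_sign_matrix (transpose P)"
  by (simp add: perm_sign_matrix_def transpose_def)

lemma perm_sign_matrix_mat_1: "perm_sign_matrix (mat 1 :: real^'n^'n)"
  by (rule perm_sign_matrixI[of id "\<lambda>_. 1"]) (auto simp: mat_def)

lemma perm_sign_matrix_transpose_mult: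
  fixes P :: "real^'n^'n"
  assumes "perm_sign_matrix P"
  shows "transpose P ** P = mat 1"
proof -
  obtain p s where p: "bij p" "\<And>i. s i = 1 \<or> s i = - 1"
    "\<And>i j. P $ i $ j = (if j = p i then s i else 0)"
    by (rule perm_sign_matrixE[OF assms]) blast
  \<comment> \<open>The normal form describes rows, so this order of the factors is the one to
    compute. For square matrices a one-sided inverse is two-sided.\<close>
  have "P ** transpose P = mat 1"
  proof -
    have "(P ** transpose P) $ i $ j = mat 1 $ i $ j" for i j
    proof -
      have "(P ** transpose P) $ i $ j = s i * P $ j $ p i"
        by (simp add: matrix_matrix_mult_def transpose_def p(3)[of i] if_distrib[of "\<lambda>a. a * _"]
            cong: if_cong)
      also have "\<dots> = mat 1 $ i $ j"
        using p(2)[of i] bij_is_inj[OF p(1)] by (auto simp: p(3) mat_def inj_eq)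
      finally show ?thesis .
    qed
    then show ?thesis
      by (simp add: vec_eq_iff)
  qed
  then show ?thesis
    using matrix_left_right_inverse by blast
qed

text \<open>All entries lie in the finite set {0, 1, -1}.\<close>

lemma finite_perm_sign_matrices: "finite {P :: real^'n^'n. perm_sign_matrix P}"
proof (rule finite_subset)
  let ?F = "UNIV \<rightarrow>\<^sub>E (UNIV \<rightarrow>\<^sub>E {0, 1, - 1}) :: ('n \<Rightarrow> 'n \<Rightarrow> real) set"
  show "{P :: real^'n^'n. perm_sign_matrix P} \<subseteq> (\<lambda>F. \<chi> i j. F i j) ` ?F"
  proof
    fix P :: "real^'n^'n"
    assume "P \<in> {P. perm_sign_matrix P}"
    then have "(\<lambda>i j. P $ i $ j) \<in> ?F"
      by (auto simp: perm_sign_matrix_def)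
    moreover have "P = (\<chi> i j. P $ i $ j)"
      by simp
    ultimately show "P \<in> (\<lambda>F. \<chi> i j. F i j) ` ?F"
      by (intro image_eqI[where x = "\<lambda>i j. P $ i $ j"])
  qed
  show "finite ((\<lambda>F. \<chi> i j. F i j) ` ?F)"
    by (intro finite_imageI finite_PiE) auto
qed

section \<open>Fully symmetric sets as orbits\<close>

lemma finite_fully_symmetric_set: "finite (fully_symmetric_set (v :: real^'n))"
proof -
  have "fully_symmetric_set v = (\<lambda>P :: real^'n^'n. P *v v) ` {P. perm_sign_matrix P}"
    by (auto simp: fully_symmetric_set_def)
  then show ?thesis
    by (simp add: finite_perm_sign_matrices)
qed

lemma self_in_fully_symmetric_set: "v \<in> fully_symmetric_set v"
  unfolding fully_symmetric_set_def using perm_sign_matrix_mat_1 matrix_vector_mul_lid by force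

lemma mult_in_fully_symmetric_set:
  "perm_sign_matrix P \<Longrightarrow> x \<in> fully_symmetric_set v \<Longrightarrow> P *v x \<in> fully_symmetric_set v"
  unfolding fully_symmetric_set_def
  by (auto simp: matrix_vector_mul_assoc intro: perm_sign_matrix_mult)

lemma perm_sign_matrix_transpose_cancel:
  fixes P :: "real^'n^'n"
  assumes "perm_sign_matrix P"
  shows "transpose P *v (P *v x) = x" "P *v (transpose P *v x) = x"
proof -
  have "transpose P ** P = mat 1"
    using assms by (rule perm_sign_matrix_transpose_mult)
  moreover from this have "P ** transpose P = mat 1"
    using matrix_left_right_inverse by blast
  ultimately show "transpose P *v (P *v x) = x" "P *v (transpose P *v x) = x"
    by (simp_all only: matrix_vector_mul_assoc matrix_vector_mul_lid)
qed

text \<open>Orbits of a group partition the space: if \<open>x = P *v a\<close>, then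
  \<open>a\<close> is recovered from \<open>x\<close> by the transpose of \<open>P\<close>, so it
  lies in every orbit containing \<open>x\<close>. The hypotheses are symmetric in the two orbits,
  so one inclusion suffices.\<close>

lemma fully_symmetric_set_eqI:
  fixes u v x :: "real^'n"
  assumes "x \<in> fully_symmetric_set u" "x \<in> fully_symmetric_set v"
  shows "fully_symmetric_set u = fully_symmetric_set v"
proof -
  have "fully_symmetric_set a \<subseteq> fully_symmetric_set b"
    if a: "x \<in> fully_symmetric_set a" and b: "x \<in> fully_symmetric_set b" for a b :: "real^'n"
  proof -
    obtain P where P: "perm_sign_matrix P" "x = P *v a"
      using a unfolding fully_symmetric_set_def by blast
    then have "a \<in> fully_symmetric_set b"
      using mult_in_fully_symmetric_set[OF perm_sign_matrix_transpose[OF P(1)] b]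
      by (simp add: perm_sign_matrix_transpose_cancel del: transpose_matrix_vector)
    then show ?thesis
      by (auto simp: fully_symmetric_set_def[of a] intro: mult_in_fully_symmetric_set)
  qed
  then show ?thesis
    using assms by blast
qed

text \<open>The transpose acts as the inverse. This allows a sum over an orbit to be reindexed by
  \<open>P\<close>.\<close>

lemma bij_betw_fully_symmetric_set:
  fixes P :: "real^'n^'n"
  assumes "perm_sign_matrix P"
  shows "bij_betw ((*v) P) (fully_symmetric_set v) (fully_symmetric_set v)"
  by (rule bij_betwI[where g = "(*v) (transpose P)"])
    (auto simp: perm_sign_matrix_transpose_cancel[OF assms]
      simp del: transpose_matrix_vector
      intro: mult_in_fully_symmetric_set assms perm_sign_matrix_transpose)

section \<open>Invariance of Lebesgue measure under signed permutations\<close>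

text \<open>Lebesgue measure is determined by its values on boxes, and the preimage of a box is a
  box whose sides are permuted and possibly reflected, hence of the same volume.\<close>

lemma lborel_perm_sign_matrix:
  fixes P :: "real^'n^'n"
  assumes "perm_sign_matrix P"
  shows "lborel = distr lborel borel ((*v) P)"
proof (rule lborel_eqI)
  obtain p s where p: "bij p" "\<And>i. s i = 1 \<or> s i = - 1"
    "\<And>i j. P $ i $ j = (if j = p i then s i else 0)"
    by (rule perm_sign_matrixE[OF assms]) blast
  have P: "(P *v x) $ i = s i * x $ p i" for x i
    using signed_perm_mult_nth[OF p(3)] .
  define q where "q = inv p"
  have q: "q (p i) = i" "p (q i) = i" for i
    using p(1) by (simp_all add: q_def bij_is_inj bij_is_surj surj_f_inv_f)
  have "bij q"
    using p(1) by (simp add: q_def bij_imp_bij_inv)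
  fix l u :: "real^'n"
  assume le: "\<And>b. b \<in> Basis \<Longrightarrow> l \<bullet> b \<le> u \<bullet> b"
  \<comment> \<open>Coordinate \<open>j\<close> of \<open>x\<close> appears in \<open>P *v x\<close>
    at position \<open>q j\<close> with sign \<open>s (q j)\<close>. A negative sign negates and
    exchanges the two bounds, which leaves the side length unchanged.\<close>
  define l' :: "real^'n" where "l' = (\<chi> j. if s (q j) = 1 then l $ q j else - u $ q j)"
  define u' :: "real^'n" where "u' = (\<chi> j. if s (q j) = 1 then u $ q j else - l $ q j)"
  have diff: "(u' - l') $ j = (u - l) $ q j" for j
    by (simp add: l'_def u'_def)
  have le_nth: "l $ i \<le> u $ i" for i
    using le[of "axis i 1"] by (simp add: inner_axis)
  have Basis_prod: "(\<Prod>b\<in>Basis. v \<bullet> b) = (\<Prod>i\<in>UNIV. v $ i)" for v :: "real^'n"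
    by (simp add: Basis_vec_def cart_eq_inner_axis axis_eq_axis prod.UNION_disjoint)
  have "(*v) P -` box l u = box l' u'"
  proof -
    have "x \<in> (*v) P -` box l u \<longleftrightarrow> x \<in> box l' u'" for x
    proof -
      \<comment> \<open>Every coordinate has the form \<open>p i\<close>, so the bounds can be
        indexed by the rows of \<open>P\<close>.\<close>
      have "x \<in> box l' u' \<longleftrightarrow> (\<forall>i. l' $ p i < x $ p i \<and> x $ p i < u' $ p i)"
        unfolding mem_box_cart by (metis q(2))
      also have "\<dots> \<longleftrightarrow> (\<forall>i. l $ i < s i * x $ p i \<and> s i * x $ p i < u $ i)"
      proof (intro all_cong1)
        show "(l' $ p i < x $ p i \<and> x $ p i < u' $ p i)
            = (l $ i < s i * x $ p i \<and> s i * x $ p i < u $ i)" for i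
          using p(2)[of i] by (auto simp: l'_def u'_def q)
      qed
      finally show ?thesis
        by (simp add: mem_box_cart P)
    qed
    then show ?thesis
      by blast
  qed
  moreover have "(*v) P \<in> borel_measurable borel"
    by (intro borel_measurable_continuous_onI linear_continuous_on
        linear_conv_bounded_linear[THEN iffD1] matrix_vector_mul_linear)
  ultimately have "emeasure (distr lborel borel ((*v) P)) (box l u) = emeasure lborel (box l' u')"
    by (simp add: emeasure_distr)
  also have "\<dots> = ennreal (\<Prod>b\<in>Basis. (u' - l') \<bullet> b)"
  proof (rule emeasure_lborel_box)
    show "l' \<bullet> b \<le> u' \<bullet> b" if "b \<in> Basis" for b
      using that le_nth by (auto simp: Basis_vec_def inner_axis l'_def u'_def)
  qed
  also have "(\<Prod>b\<in>Basis. (u' - l') \<bullet> b) = (\<Prod>j\<in>UNIV. (u - l) $ q j)"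
    unfolding Basis_prod diff ..
  also have "\<dots> = (\<Prod>b\<in>Basis. (u - l) \<bullet> b)"
    unfolding Basis_prod using \<open>bij q\<close> by (rule prod.reindex_bij_betw)
  finally show "emeasure (distr lborel borel ((*v) P)) (box l u) = ennreal (\<Prod>b\<in>Basis. (u - l) \<bullet> b)" .
qed simp

text \<open>The Borel statement extends to the completion because the image measure on Borel sets is
  \<open>lborel\<close> itself, so preimages of null sets are null.\<close>

lemma lebesgue_perm_sign_matrix:
  fixes P :: "real^'n^'n"
  assumes "perm_sign_matrix P"
  shows "(*v) P \<in> lebesgue \<rightarrow>\<^sub>M lebesgue" and "lebesgue = distr lebesgue lebesgue ((*v) P)"
proof -
  have P_borel [measurable]: "(*v) P \<in> borel_measurable borel"
    by (intro borel_measurable_continuous_onI linear_continuous_on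
        linear_conv_bounded_linear[THEN iffD1] matrix_vector_mul_linear)
  have distr: "distr lebesgue lborel ((*v) P) = lborel"
    using lborel_perm_sign_matrix[OF assms] by (simp add: distr_completion cong: distr_cong)
  then show "(*v) P \<in> lebesgue \<rightarrow>\<^sub>M lebesgue"
    by (simp add: completion.measurable_completion2 measurable_completion)
  have "lebesgue = completion (distr lebesgue lborel ((*v) P))"
    by (simp add: distr)
  also have "\<dots> = distr lebesgue lebesgue ((*v) P)"
    by (subst completion.completion_distr_eq) (auto simp: distr measurable_completion)
  finally show "lebesgue = distr lebesgue lebesgue ((*v) P)" .
qed

section \<open>Integrals against the density and the kernel mean\<close>

text \<open>As \<open>\<mu>\<close> may live on a smaller sigma-algebra, it is treated as the image
  of the density measure under the identity map. The integrand is extended by zero outside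
  \<open>\<Omega>\<close> so that linear maps can act on the whole space.\<close>

lemma integral_lebesgue_density:
  fixes g :: "real^'n \<Rightarrow> real"
  assumes dens: "has_lebesgue_density \<mu> \<Omega> f" and g: "g \<in> borel_measurable \<mu>"
  shows "(\<lambda>x. indicator \<Omega> x * (f x * g x)) \<in> borel_measurable lebesgue"
    and "(\<integral>x. g x \<partial>\<mu>) = (\<integral>x. indicator \<Omega> x * (f x * g x) \<partial>lebesgue)"
proof -
  let ?D = "density (lebesgue_on \<Omega>) (\<lambda>x. ennreal (f x))"
  have \<Omega>: "\<Omega> \<in> sets lebesgue" and space: "space \<mu> = \<Omega>" and sub: "sets \<mu> \<subseteq> sets (lebesgue_on \<Omega>)"
    and f: "f \<in> borel_measurable (lebesgue_on \<Omega>)" "\<And>x. x \<in> \<Omega> \<Longrightarrow> 0 \<le> f x"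
    and em: "\<And>A. A \<in> sets \<mu> \<Longrightarrow> emeasure \<mu> A = emeasure ?D A"
    using dens by (auto simp: has_lebesgue_density_def)
  have id: "(\<lambda>x. x) \<in> lebesgue_on \<Omega> \<rightarrow>\<^sub>M \<mu>"
  proof (rule measurableI)
    show "(\<lambda>x. x) -` A \<inter> space (lebesgue_on \<Omega>) \<in> sets (lebesgue_on \<Omega>)" if "A \<in> sets \<mu>" for A
      using sets.sets_into_space[OF that] that sub space by (auto simp: Int_absorb2)
  qed (simp add: space)
  have "\<mu> = distr ?D \<mu> (\<lambda>x. x)"
  proof (rule measure_eqI)
    show "emeasure \<mu> A = emeasure (distr ?D \<mu> (\<lambda>x. x)) A" if "A \<in> sets \<mu>" for A
      using em[OF that] sets.sets_into_space[OF that] that id space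
      by (simp add: emeasure_distr Int_absorb2)
  qed simp
  then have "(\<integral>x. g x \<partial>\<mu>) = (\<integral>x. g x \<partial>distr ?D \<mu> (\<lambda>x. x))"
    by simp
  also have "\<dots> = (\<integral>x. g x \<partial>?D)"
    using id g by (simp add: integral_distr)
  also have "\<dots> = (\<integral>x. f x *\<^sub>R g x \<partial>lebesgue_on \<Omega>)"
    using measurable_compose[OF id g] f by (intro integral_density) (auto intro!: AE_I2)
  also have "\<dots> = (\<integral>x. indicator \<Omega> x * (f x * g x) \<partial>lebesgue)"
    using \<Omega> by (subst integral_restrict_space) auto
  finally show "(\<integral>x. g x \<partial>\<mu>) = (\<integral>x. indicator \<Omega> x * (f x * g x) \<partial>lebesgue)" .
  have "(\<lambda>x. f x * g x) \<in> borel_measurable (lebesgue_on \<Omega>)"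
    using measurable_compose[OF id g] f(1) by (intro borel_measurable_times) auto
  then show "(\<lambda>x. indicator \<Omega> x * (f x * g x)) \<in> borel_measurable lebesgue"
    using \<Omega> by (subst (asm) borel_measurable_restrict_space_iff) auto
qed

text \<open>Substitute \<open>P *v y\<close> for the integration variable: Lebesgue measure, the
  indicator of \<open>\<Omega>\<close>, the density and the kernel are all invariant.\<close>

lemma kernel_mean_perm_sign_matrix:
  fixes P :: "real^'n^'n"
  assumes inv: "\<And>P. perm_sign_matrix P \<Longrightarrow> (\<lambda>x. P *v x) ` \<Omega> = \<Omega>"
    and dens: "has_lebesgue_density \<mu> \<Omega> f"
    and sym_f: "fully_symmetric_fun \<Omega> f"
    and ker: "is_kernel \<mu> k" and sym_k: "fully_symmetric_kernel \<Omega> k"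
    and P: "perm_sign_matrix P" and x: "x \<in> \<Omega>"
  shows "kernel_mean \<mu> k (P *v x) = kernel_mean \<mu> k x"
proof -
  have space: "space \<mu> = \<Omega>"
    using dens by (simp add: has_lebesgue_density_def)
  have meas: "k z \<in> borel_measurable \<mu>" if "z \<in> \<Omega>" for z
  proof -
    have "(\<lambda>y. case (z, y) of (x, y) \<Rightarrow> k x y) \<in> borel_measurable \<mu>"
      using ker that space by (intro measurable_compose_Pair1) (auto simp: is_kernel_def)
    then show ?thesis
      by simp
  qed
  \<comment> \<open>Both \<open>P\<close> and its inverse, the transpose, map
    \<open>\<Omega>\<close> onto itself.\<close>
  have mem: "P *v y \<in> \<Omega> \<longleftrightarrow> y \<in> \<Omega>" for y
    using inv[OF P] inv[OF perm_sign_matrix_transpose[OF P]]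
    by (metis perm_sign_matrix_transpose_cancel(1)[OF P] imageI)
  have Px: "P *v x \<in> \<Omega>"
    using mem x by simp
  have "kernel_mean \<mu> k (P *v x) = (\<integral>y. indicator \<Omega> y * (f y * k (P *v x) y) \<partial>lebesgue)"
    unfolding kernel_mean_def by (rule integral_lebesgue_density(2)[OF dens meas[OF Px]])
  also have "\<dots> = (\<integral>y. indicator \<Omega> y * (f y * k (P *v x) y) \<partial>distr lebesgue lebesgue ((*v) P))"
    using lebesgue_perm_sign_matrix(2)[OF P] by simp
  also have "\<dots> = (\<integral>y. indicator \<Omega> (P *v y) * (f (P *v y) * k (P *v x) (P *v y)) \<partial>lebesgue)"
    by (rule integral_distr[OF lebesgue_perm_sign_matrix(1)[OF P]
          integral_lebesgue_density(1)[OF dens meas[OF Px]]])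
  also have "\<dots> = (\<integral>y. indicator \<Omega> y * (f y * k x y) \<partial>lebesgue)"
  proof (rule Bochner_Integration.integral_cong[OF refl])
    show "indicator \<Omega> (P *v y) * (f (P *v y) * k (P *v x) (P *v y)) = indicator \<Omega> y * (f y * k x y)" for y
      using P x sym_f sym_k mem[of y]
      by (auto simp: fully_symmetric_fun_def fully_symmetric_kernel_def split: split_indicator)
  qed
  also have "\<dots> = kernel_mean \<mu> k x"
    unfolding kernel_mean_def by (rule integral_lebesgue_density(2)[OF dens meas[OF x], symmetric])
  finally show ?thesis .
qed

section \<open>Uniqueness of the quadrature weights\<close>

text \<open>If the Gram matrix annihilates \<open>c\<close>, then its quadratic form vanishes at
  \<open>c\<close>, which strict positivity excludes for non-zero \<open>c\<close>. The enumeration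
  \<open>e\<close> of \<open>X\<close> matches the indexing by natural numbers in
  \<open>positive_definite_kernel\<close>.\<close>

lemma positive_definite_kernel_eq_0:
  assumes pd: "positive_definite_kernel \<Omega> k" and X: "finite X" "X \<subseteq> \<Omega>"
    and ker: "\<And>x. x \<in> X \<Longrightarrow> (\<Sum>y\<in>X. k x y * c y) = 0" and "x \<in> X"
  shows "c x = 0"
proof (rule ccontr)
  assume "c x \<noteq> 0"
  obtain e where e: "bij_betw e {..<card X} X"
    using X(1) ex_bij_betw_nat_finite lessThan_atLeast0 by metis
  then obtain i where "i < card X" "e i = x"
    using \<open>x \<in> X\<close> by (metis bij_betw_iff_bijections lessThan_iff)
  then have "\<exists>i<card X. c (e i) \<noteq> 0"
    using \<open>c x \<noteq> 0\<close> by auto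
  moreover have "inj_on e {..<card X}" "e ` {..<card X} \<subseteq> \<Omega>"
    using e X(2) by (auto simp: bij_betw_def)
  ultimately have "0 < (\<Sum>i<card X. \<Sum>j<card X. c (e i) * k (e i) (e j) * c (e j))"
    using pd[unfolded positive_definite_kernel_def, rule_format, of e "card X" "\<lambda>i. c (e i)"] by blast
  also have "\<dots> = (\<Sum>i<card X. c (e i) * (\<Sum>y\<in>X. k (e i) y * c y))"
    by (simp add: sum.reindex_bij_betw[OF e, symmetric] sum_distrib_left mult.assoc)
  also have "\<dots> = 0"
    using bij_betwE[OF e] by (intro sum.neutral) (simp add: ker)
  finally show False
    by simp
qed

text \<open>Two solutions differ by a vector that the Gram matrix annihilates, so they agree on
  \<open>X\<close>; off \<open>X\<close> both are zero.\<close>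

lemma kernel_quadrature_weights_eqI:
  assumes pd: "positive_definite_kernel \<Omega> k" and X: "finite X" "X \<subseteq> \<Omega>"
    and w0: "\<And>x. x \<notin> X \<Longrightarrow> w x = 0"
    and w: "\<And>x. x \<in> X \<Longrightarrow> (\<Sum>y\<in>X. k x y * w y) = kernel_mean \<mu> k x"
  shows "kernel_quadrature_weights \<mu> k X = w"
  unfolding kernel_quadrature_weights_def
proof (rule the_equality)
  fix v
  assume v: "(\<forall>x. x \<notin> X \<longrightarrow> v x = 0) \<and> (\<forall>x\<in>X. (\<Sum>y\<in>X. k x y * v y) = kernel_mean \<mu> k x)"
  have "(\<Sum>y\<in>X. k x y * (v y - w y)) = 0" if "x \<in> X" for x
    using v w that by (simp add: right_diff_distrib sum_subtractf)
  then have "v x - w x = 0" if "x \<in> X" for x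
    using positive_definite_kernel_eq_0[OF pd X, of "\<lambda>y. v y - w y"] that by blast
  then show "v = w"
    using v w0 by (metis eq_iff_diff_eq_0 ext)
qed (use w0 w in auto)

section \<open>Reduction of the Gram system to one equation per orbit\<close>

theorem theorem3p6:
  fixes \<Omega> :: "(real^'n) set"
    and \<mu> :: "(real^'n) measure"
    and k :: "real^'n \<Rightarrow> real^'n \<Rightarrow> real"
    and f\<^sub>\<mu> :: "real^'n \<Rightarrow> real"
    and lam :: "'j::finite \<Rightarrow> real^'n"
  assumes "\<And>P :: real^'n^'n. perm_sign_matrix P \<Longrightarrow> (\<lambda>x. P *v x) ` \<Omega> = \<Omega>"
    and "has_lebesgue_density \<mu> \<Omega> f\<^sub>\<mu>"
    and "fully_symmetric_fun \<Omega> f\<^sub>\<mu>"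
    and "is_kernel \<mu> k"
    and "positive_definite_kernel \<Omega> k"
    and "fully_symmetric_kernel \<Omega> k"
    and "integrable \<mu> (\<lambda>x. sqrt (k x x))"
    and "\<And>j. lam j \<in> \<Omega>"
    and "\<And>j i. 0 \<le> lam j $ i"
    and "inj (\<lambda>j. fully_symmetric_set (lam j))"
  shows "\<exists>(S :: real^'j^'j) (w :: real^'j).
           (\<forall>f :: real^'n \<Rightarrow> real.
              kernel_quadrature \<mu> k (\<Union>j. fully_symmetric_set (lam j)) f =
                (\<Sum>j\<in>UNIV. w $ j * (\<Sum>x\<in>fully_symmetric_set (lam j). f x))) \<and>
           (\<forall>i j. \<forall>x\<^sub>i\<in>fully_symmetric_set (lam i).
              (\<Sum>x\<in>fully_symmetric_set (lam j). k x\<^sub>i x) = S $ i $ j) \<and>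
           invertible S \<and>
           (\<forall>i. (\<Sum>j\<in>UNIV. S $ i $ j * w $ j) = kernel_mean \<mu> k (lam i))"
proof -
  let ?O = "\<lambda>j. fully_symmetric_set (lam j)"
  let ?X = "\<Union>j. ?O j"
  \<comment> \<open>Orbits that share a point coincide, and distinct indices generate distinct
    orbits, so each node determines its index.\<close>
  have disj: "i = j" if "x \<in> ?O i" "x \<in> ?O j" for x i j
    using assms(10) fully_symmetric_set_eqI[OF that] by (simp add: inj_def)
  have fin: "finite (?O j)" for j
    by (rule finite_fully_symmetric_set)
  have mem: "P *v x \<in> \<Omega>" if "perm_sign_matrix P" "x \<in> \<Omega>" for P x
    using assms(1)[OF that(1)] that(2) by blast
  have X: "finite ?X" "?X \<subseteq> \<Omega>"
    using fin assms(8) by (auto simp: fully_symmetric_set_def intro!: mem)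

  \<comment> \<open>Turns one weight per orbit into one weight per node. At most one summand is
    non-zero; off the node set the value is 0, as \<open>kernel_quadrature_weights\<close>
    demands.\<close>
  define spread :: "real^'j \<Rightarrow> real^'n \<Rightarrow> real"
    where "spread v x = (\<Sum>j\<in>UNIV. if x \<in> ?O j then v $ j else 0)" for v x
  have spread: "spread v x = v $ j" if "x \<in> ?O j" for v x j
  proof -
    have "spread v x = (\<Sum>i\<in>UNIV. if i = j then v $ i else 0)"
      unfolding spread_def using that disj by (intro sum.cong) auto
    then show ?thesis
      by simp
  qed
  have sum_spread: "(\<Sum>x\<in>?X. g x * spread v x) = (\<Sum>j\<in>UNIV. v $ j * (\<Sum>x\<in>?O j. g x))" for g v
  proof -
    have "(\<Sum>x\<in>?X. g x * spread v x) = (\<Sum>j\<in>UNIV. \<Sum>x\<in>?O j. g x * spread v x)"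
      using fin disj by (intro sum.UNION_disjoint) auto
    also have "\<dots> = (\<Sum>j\<in>UNIV. v $ j * (\<Sum>x\<in>?O j. g x))"
      by (auto simp: spread sum_distrib_left mult.commute intro!: sum.cong)
    finally show ?thesis .
  qed

  \<comment> \<open>The generator \<open>lam i\<close> serves as representative of its orbit. Moving
    it to another point by \<open>P\<close> is compensated by reindexing the sum over the orbit of
    \<open>lam j\<close> by the same \<open>P\<close>.\<close>
  define S :: "real^'j^'j" where "S = (\<chi> i j. \<Sum>x\<in>?O j. k (lam i) x)"
  have S: "(\<Sum>x\<in>?O j. k y x) = S $ i $ j" if y: "y \<in> ?O i" for y i j
  proof -
    obtain P where P: "perm_sign_matrix P" "y = P *v lam i"
      using y by (auto simp: fully_symmetric_set_def)
    have "(\<Sum>x\<in>?O j. k y x) = (\<Sum>x\<in>?O j. k (P *v lam i) (P *v x))"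
      unfolding P(2) by (rule sum.reindex_bij_betw[OF bij_betw_fully_symmetric_set[OF P(1)], symmetric])
    also have "\<dots> = (\<Sum>x\<in>?O j. k (lam i) x)"
    proof (rule sum.cong[OF refl])
      show "k (P *v lam i) (P *v x) = k (lam i) x" if "x \<in> ?O j" for x
        using assms(6) P(1) assms(8)[of i] X(2) that unfolding fully_symmetric_kernel_def by blast
    qed
    finally show ?thesis
      by (simp add: S_def)
  qed
  \<comment> \<open>On functions constant on orbits the Gram matrix acts as \<open>S\<close>. This
    serves both the invertibility of \<open>S\<close> and the solution of the full system.\<close>
  have gram_spread: "(\<Sum>x\<in>?X. k y x * spread v x) = (S *v v) $ i" if "y \<in> ?O i" for y i v
    by (simp add: sum_spread S[OF that] matrix_vector_mult_def mult.commute)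

  have "v = 0" if "S *v v = 0" for v
  proof -
    have "(\<Sum>x\<in>?X. k y x * spread v x) = 0" if "y \<in> ?X" for y
      using that gram_spread \<open>S *v v = 0\<close> by fastforce
    then have "spread v x = 0" if "x \<in> ?X" for x
      using positive_definite_kernel_eq_0[OF assms(5) X] that by blast
    then have "v $ j = 0" for j
      using spread[OF self_in_fully_symmetric_set] self_in_fully_symmetric_set by (metis UN_I UNIV_I)
    then show ?thesis
      by (simp add: vec_eq_iff)
  qed
  then have inv: "invertible S"
    by (simp add: invertible_left_inverse matrix_left_invertible_ker)
  then obtain w where w: "S *v w = (\<chi> i. kernel_mean \<mu> k (lam i))"
    by (metis invertible_right_inverse matrix_right_invertible_surjective surjD)

  \<comment> \<open>Both sides of the full system are constant on each orbit, so the equations at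
    the generators imply those at all nodes.\<close>
  have "kernel_mean \<mu> k y = kernel_mean \<mu> k (lam i)" if "y \<in> ?O i" for y i
    using that kernel_mean_perm_sign_matrix[OF assms(1-4,6)] assms(8)
    by (auto simp: fully_symmetric_set_def)
  then have "(\<Sum>y\<in>?X. k x y * spread w y) = kernel_mean \<mu> k x" if "x \<in> ?X" for x
    using that gram_spread w by fastforce
  moreover have "spread w x = 0" if "x \<notin> ?X" for x
    using that by (auto simp: spread_def intro!: sum.neutral)
  ultimately have "kernel_quadrature_weights \<mu> k ?X = spread w"
    by (intro kernel_quadrature_weights_eqI[OF assms(5) X])
  then have "kernel_quadrature \<mu> k ?X f = (\<Sum>j\<in>UNIV. w $ j * (\<Sum>x\<in>?O j. f x))" for f
    using sum_spread[of f w] by (simp add: kernel_quadrature_def mult.commute)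
  moreover have "(\<Sum>j\<in>UNIV. S $ i $ j * w $ j) = kernel_mean \<mu> k (lam i)" for i
    using arg_cong[OF w, of "\<lambda>v. v $ i"] by (simp add: matrix_vector_mult_def)
  ultimately show ?thesis
    using S inv by blast
qed

end
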